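(* $\mathrm{LOP}\notin \mathsf{MIN}^{dt}$; that is, the Linear Ordering Principle does not admit an efficient (complexity $\mathrm{polylog}$ in the input length) decision-tree reduction (formulation) to the Least Number problem.
   Context: A query search problem is a sequence $R=(R_n)$ of relations $R_n\subseteq\{0,1\}^n\times\mathcal{O}_n$; it is total if every $x$ has some $o$ with $(x,o)\in R_n$. $R\in\mathrm{TF}\Sigma_2^{dt}$ if it is total and for every $n$ and $o\in\mathcal{O}_n$ there are decision trees $V_{o,z}$ of depth $\mathrm{polylog}(n)$, one for each string $z$ of length $\mathrm{polylog}(n)$, with $R_n(x,o)$ iff $V_{o,z}(x)=1$ for all $z$. For total search problems $R\subseteq\{0,1\}^n\times\mathcal{O}_n$, $S\subseteq\{0,1\}^m\times\mathcal{O}'_m$, an $S$-formulation of $R$ consists of $f_i:\{0,1\}^n\to\{0,1\}$ ($i\in[m]$) and $g_o:\{0,1\}^n\to\mathcal{O}_n$ ($o\in\mathcal{O}'_m$) with $S(f(x),o)\Rightarrow R(x,g_o(x))$, $f(x)=(f_1(x),\dots,f_m(x))$; its complexity is $\log m$ plus the maximum decision-tree depth of the $f_i,g_o$. For sequences, $R\le_{dt}S$ if for each $n$ some $S_m$-formulation of $R_n$ has complexity $\mathrm{polylog}(n)$. Least Number ($\mathrm{Min}$): the input is $f:[2^n]\to\{0,1\}$ given by its $2^n$ bits; a solution is $\bot$ if $f(x)=0$ for all $x$, or an $x$ with $f(x)=1$ and $f(y)=0$ for all $y<x$. $\mathsf{MIN}^{dt}$ is the class of problems $Q\in\mathrm{TF}\Sigma_2^{dt}$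 with $Q\le_{dt}\mathrm{Min}$. Linear Ordering Principle ($\mathrm{LOP}$): input a relation $\prec$ on $[N]$ given by bits $x_{i,j}$ ($x_{i,j}=1$ iff $i\prec j$); a solution is either an element $a$ with $a\prec b$ for all $b\neq a$, or distinct $a,b,c$ with $a\prec a$, or ($a\not\prec b$ and $b\not\prec a$), or ($a\prec b$, $b\prec c$, $a\not\prec c$). *)

theory Defs
  imports Complex_Main "HOL-Library.Landau_Symbols"
begin

definition cube :: "nat \<Rightarrow> bool list set" where
  "cube n = {x. length x = n}"

text \<open>Inner nodes query an input bit: the left subtree is taken on answer 0, the right one on
  answer 1.\<close>

datatype 'a dtree = Leaf 'a | Query nat "'a dtree" "'a dtree"

fun wf_dtree :: "nat \<Rightarrow> 'a dtree \<Rightarrow> bool" where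
  "wf_dtree n (Leaf a) = True"
| "wf_dtree n (Query i l r) = (i < n \<and> wf_dtree n l \<and> wf_dtree n r)"

fun depth :: "'a dtree \<Rightarrow> nat" where
  "depth (Leaf a) = 0"
| "depth (Query i l r) = Suc (max (depth l) (depth r))"

fun run :: "'a dtree \<Rightarrow> bool list \<Rightarrow> 'a" where
  "run (Leaf a) x = a"
| "run (Query i l r) x = (if x ! i then run r x else run l x)"

definition computes :: "nat \<Rightarrow> 'a dtree \<Rightarrow> (bool list \<Rightarrow> 'a) \<Rightarrow> bool" where
  "computes n T h \<longleftrightarrow> wf_dtree n T \<and> (\<forall>x\<in>cube n. run T x = h x)"

definition dt_depth :: "nat \<Rightarrow> (bool list \<Rightarrow> 'a) \<Rightarrow> nat" where
  "dt_depth n h = (LEAST d. \<exists>T. computes n T h \<and> depth T = d)"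

definition polylog :: "(nat \<Rightarrow> real) \<Rightarrow> bool" where
  "polylog p \<longleftrightarrow> (\<exists>k::nat. p \<in> O(\<lambda>n. ln (real n) ^ k))"

text \<open>A sequence \<open>(R\<^sub>n)\<close> is indexed by the number \<open>n\<close> of input bits. Natural problems have inputs
  of certain lengths only (a relation on \<open>[N]\<close> has \<open>N\<^sup>2\<close> bits), so \<open>n\<close> ranges over the set
  \<open>lengths R\<close>; nothing is required at other \<open>n\<close>.\<close>

record 'o search_problem =
  lengths :: "nat set"
  sols :: "nat \<Rightarrow> 'o set"
  rel :: "nat \<Rightarrow> (bool list \<times> 'o) set"

definition query_search_problem :: "'o search_problem \<Rightarrow> bool" where
  "query_search_problem R \<longleftrightarrow> (\<forall>n\<in>lengths R. rel R n \<subseteq> cube n \<times> sols R n)"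

definition total :: "'o search_problem \<Rightarrow> bool" where
  "total R \<longleftrightarrow> (\<forall>n\<in>lengths R. \<forall>x\<in>cube n. \<exists>s\<in>sols R n. (x, s) \<in> rel R n)"

text \<open>The length \<open>l n\<close> of the strings \<open>z\<close> and the depth bound \<open>p n\<close> are uniform in the solution.\<close>

definition TFSigma2_dt :: "'o search_problem set" where
  "TFSigma2_dt = {R. query_search_problem R \<and> total R \<and>
     (\<exists>l p. polylog (\<lambda>n. real (l n)) \<and> polylog p \<and>
       (\<forall>n\<in>lengths R. \<forall>s\<in>sols R n. \<exists>V :: bool list \<Rightarrow> bool dtree.
          (\<forall>z\<in>cube (l n). wf_dtree n (V z) \<and> real (depth (V z)) \<le> p n) \<and>
          (\<forall>x\<in>cube n. (x, s) \<in> rel R n \<longleftrightarrow> (\<forall>z\<in>cube (l n). run (V z) x))))}"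

text \<open>\<open>formulation R n S m f g\<close>: the functions \<open>f i\<close> (\<open>i < m\<close>) and \<open>g s\<close> form an
  \<open>S\<^sub>m\<close>-formulation of \<open>R\<^sub>n\<close>.\<close>

definition formulation ::
  "'o search_problem \<Rightarrow> nat \<Rightarrow> 'p search_problem \<Rightarrow> nat \<Rightarrow>
   (nat \<Rightarrow> bool list \<Rightarrow> bool) \<Rightarrow> ('p \<Rightarrow> bool list \<Rightarrow> 'o) \<Rightarrow> bool" where
  "formulation R n S m f g \<longleftrightarrow>
     (\<forall>s\<in>sols S m. \<forall>x\<in>cube n. g s x \<in> sols R n) \<and>
     (\<forall>x\<in>cube n. \<forall>s\<in>sols S m.
        (map (\<lambda>i. f i x) [0..<m], s) \<in> rel S m \<longrightarrow> (x, g s x) \<in> rel R n)"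

text \<open>The maximum is over a finite set even if \<open>sols S m\<close> is infinite, since every function on
  \<open>{0,1}\<^sup>n\<close> has a decision tree of depth at most \<open>n\<close>; it is nonempty if \<open>S\<close> is total.\<close>

definition complexity ::
  "nat \<Rightarrow> 'p search_problem \<Rightarrow> nat \<Rightarrow>
   (nat \<Rightarrow> bool list \<Rightarrow> bool) \<Rightarrow> ('p \<Rightarrow> bool list \<Rightarrow> 'o) \<Rightarrow> real" where
  "complexity n S m f g = log 2 (real m) +
     real (Max ((\<lambda>i. dt_depth n (f i)) ` {..<m} \<union> (\<lambda>s. dt_depth n (g s)) ` sols S m))"

definition dt_reducible :: "'o search_problem \<Rightarrow> 'p search_problem \<Rightarrow> bool"
    (infix "\<le>\<^sub>d\<^sub>t" 50) where
  "R \<le>\<^sub>d\<^sub>t S \<longleftrightarrow> (\<exists>p. polylog p \<and>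
     (\<forall>n\<in>lengths R. \<exists>m\<in>lengths S. \<exists>f g. formulation R n S m f g \<and> complexity n S m f g \<le> p n))"

text \<open>A function \<open>f : [2\<^sup>k] \<rightarrow> {0,1}\<close> is the list of its \<open>2\<^sup>k\<close> values; \<open>None\<close> is \<open>\<bottom>\<close>.\<close>

definition Least_Number :: "nat option search_problem" where
  "Least_Number = \<lparr>
     lengths = range (\<lambda>k. 2 ^ k),
     sols = (\<lambda>m. insert None (Some ` {..<m})),
     rel = (\<lambda>m. {(x, None) | x. x \<in> cube m \<and> (\<forall>i<m. \<not> x ! i)} \<union>
               {(x, Some i) | x i. x \<in> cube m \<and> i < m \<and> x ! i \<and> (\<forall>j<i. \<not> x ! j)})\<rparr>"

definition MIN_dt :: "'o search_problem set" where
  "MIN_dt = {Q \<in> TFSigma2_dt. Q \<le>\<^sub>d\<^sub>t Least_Number}"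

datatype lop_sol = Minimum nat | Violation nat nat nat

definition prec :: "nat \<Rightarrow> bool list \<Rightarrow> nat \<Rightarrow> nat \<Rightarrow> bool" where
  "prec N x i j \<longleftrightarrow> x ! (i * N + j)"

definition LOP_sols :: "nat \<Rightarrow> lop_sol set" where
  "LOP_sols N = {Minimum a | a. a < N} \<union>
     {Violation a b c | a b c. a < N \<and> b < N \<and> c < N \<and> distinct [a, b, c]}"

fun LOP_holds :: "nat \<Rightarrow> bool list \<Rightarrow> lop_sol \<Rightarrow> bool" where
  "LOP_holds N x (Minimum a) \<longleftrightarrow> (\<forall>b<N. b \<noteq> a \<longrightarrow> prec N x a b)"
| "LOP_holds N x (Violation a b c) \<longleftrightarrow>
     prec N x a a \<or>
     (\<not> prec N x a b \<and> \<not> prec N x b a) \<or>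
     (prec N x a b \<and> prec N x b c \<and> \<not> prec N x a c)"

text \<open>We require \<open>N \<ge> 3\<close>: as violations are triples of distinct elements, the principle is not
  total for \<open>N = 0\<close> and \<open>N = 2\<close> (for \<open>N = 2\<close>, the empty relation has no solution). The union
  has at most one member, as \<open>N\<close> is determined by the number \<open>n = N\<^sup>2\<close> of bits.\<close>

definition LOP :: "lop_sol search_problem" where
  "LOP = \<lparr>
     lengths = {N\<^sup>2 | N. 3 \<le> N},
     sols = (\<lambda>n. \<Union>N\<in>{N. N\<^sup>2 = n}. LOP_sols N),
     rel = (\<lambda>n. \<Union>N\<in>{N. N\<^sup>2 = n}. {(x, s). x \<in> cube n \<and> s \<in> LOP_sols N \<and> LOP_holds N x s})\<rparr>"

end

theory Submission
  imports Defs "HOL-Real_Asymp.Real_Asymp"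
begin

text \<open>Restrict a formulation to the linear orders and take the first \<open>f\<^sub>i\<close> that accepts some
  linear order \<open>x\<close>, or \<open>\<bottom>\<close> if there is none. Every linear order that agrees with \<open>x\<close> on the few
  bits read by \<open>f\<^sub>i\<close> and \<open>g\<^sub>i\<close> on input \<open>x\<close> then has the same first accepting index, hence
  the same solution, which can only be its minimum. But moving an element that does not occur in
  these bits to the bottom of \<open>x\<close> changes the minimum. So the depth is linear in \<open>N\<close>.\<close>

section \<open>Decision trees and certificates\<close>

fun queried :: "'a dtree \<Rightarrow> bool list \<Rightarrow> nat set" where
  "queried (Leaf a) x = {}"
| "queried (Query i l r) x = insert i (if x ! i then queried r x else queried l x)"

lemma finite_queried [simp]: "finite (queried T x)"
  by (induction T) auto

lemma card_queried_le: "card (queried T x) \<le> depth T"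
proof (induction T)
  case (Query i l r)
  have "card (queried (Query i l r) x) \<le> Suc (card (if x ! i then queried r x else queried l x))"
    by (simp add: card_insert_if)
  with Query show ?case by (auto split: if_splits)
qed simp

lemma queried_subset: "wf_dtree n T \<Longrightarrow> queried T x \<subseteq> {..<n}"
  by (induction T) auto

lemma run_cong: "(\<And>i. i \<in> queried T x \<Longrightarrow> x ! i = y ! i) \<Longrightarrow> run T x = run T y"
  by (induction T) (auto split: if_splits)

lemma finite_cube: "finite (cube n)"
  unfolding cube_def using finite_lists_length_eq[of "UNIV :: bool set" n] by simp

text \<open>Stated for subsets of the cube to allow induction: if \<open>h\<close> is not constant
  on \<open>A\<close>, querying a bit that separates two points of \<open>A\<close> leaves two
  strictly smaller sets.\<close>

lemma dtree_on_subset_exists: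
  assumes "A \<subseteq> cube n"
  shows "\<exists>T. wf_dtree n T \<and> (\<forall>x\<in>A. run T x = h x)"
proof -
  have "finite A" using assms finite_cube finite_subset by blast
  then show ?thesis using assms
  proof (induction A rule: finite_psubset_induct)
    case (psubset A)
    show ?case
    proof (cases "\<exists>c. \<forall>x\<in>A. h x = c")
      case True
      then obtain c where "\<forall>x\<in>A. h x = c" by blast
      then show ?thesis by (intro exI[of _ "Leaf c"]) simp
    next
      case False
      then obtain x y where xy: "x \<in> A" "y \<in> A" "h x \<noteq> h y" by metis
      then have "length x = n" "length y = n" "x \<noteq> y"
        using psubset.prems by (auto simp: cube_def)
      then obtain i where i: "i < n" "x ! i \<noteq> y ! i"
        by (auto simp: list_eq_iff_nth_eq)
      have "{z\<in>A. z ! i} \<subset> A" "{z\<in>A. \<not> z ! i} \<subset> A" using xy i by blast+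
      with psubset.prems obtain r l where
        "wf_dtree n r" "\<forall>z\<in>{z\<in>A. z ! i}. run r z = h z"
        "wf_dtree n l" "\<forall>z\<in>{z\<in>A. \<not> z ! i}. run l z = h z"
        using psubset.IH[of "{z\<in>A. z ! i}"] psubset.IH[of "{z\<in>A. \<not> z ! i}"] by blast
      with i show ?thesis by (intro exI[of _ "Query i l r"]) auto
    qed
  qed
qed

text \<open>The \<open>LEAST\<close> in \<open>dt_depth\<close> is meaningful only because some tree
  computes \<open>h\<close>.\<close>

lemma dt_depth_attained: "\<exists>T. computes n T h \<and> depth T = dt_depth n h"
proof -
  obtain T where "computes n T h"
    using dtree_on_subset_exists[of "cube n" n h] unfolding computes_def by auto
  then show ?thesis unfolding dt_depth_def by (rule_tac LeastI_ex) blast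
qed

text \<open>Inputs that agree with \<open>x\<close> on the bits queried along its path in an optimal
  tree follow the same path.\<close>

lemma small_certificate:
  assumes "x \<in> cube n"
  obtains Q where "Q \<subseteq> {..<n}" "card Q \<le> dt_depth n h"
    "\<forall>y\<in>cube n. (\<forall>i\<in>Q. x ! i = y ! i) \<longrightarrow> h y = h x"
proof -
  obtain T where T: "computes n T h" "depth T = dt_depth n h"
    using dt_depth_attained by blast
  show ?thesis
  proof (rule that[of "queried T x"])
    show "queried T x \<subseteq> {..<n}" using T(1) queried_subset unfolding computes_def by blast
    show "card (queried T x) \<le> dt_depth n h" using card_queried_le[of T x] T(2) by simp
    show "\<forall>y\<in>cube n. (\<forall>i\<in>queried T x. x ! i = y ! i) \<longrightarrow> h y = h x"
      using run_cong[of T x] assms T(1) unfolding computes_def by metis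
  qed
qed

section \<open>Stable solutions from Least Number\<close>

lemma Least_Number_stable_solution:
  assumes "X \<noteq> {}" "X \<subseteq> cube n" "\<forall>i<m. dt_depth n (f i) \<le> d"
  obtains x s Q where "x \<in> X" "s \<in> sols Least_Number m" "Q \<subseteq> {..<n}" "card Q \<le> d"
    "\<forall>y\<in>X. (\<forall>i\<in>Q. x ! i = y ! i) \<longrightarrow>
       (map (\<lambda>i. f i y) [0..<m], s) \<in> rel Least_Number m"
proof (cases "\<exists>i<m. \<exists>x\<in>X. f i x")
  case True
  \<comment> \<open>The minimum is over all of \<open>X\<close> rather than one input, so the
    earlier bits vanish throughout \<open>X\<close> and only the value of \<open>f i\<close> has to
    be certified.\<close>
  define i where "i = (LEAST i. i < m \<and> (\<exists>x\<in>X. f i x))"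
  have "i < m \<and> (\<exists>x\<in>X. f i x)" unfolding i_def using True by (rule LeastI_ex)
  then obtain x where i: "i < m" and x: "x \<in> X" "f i x" by blast
  have first: "\<not> f j y" if "j < i" "y \<in> X" for j y
    using not_less_Least[of j "\<lambda>i. i < m \<and> (\<exists>x\<in>X. f i x)"] that i unfolding i_def by auto
  obtain Q where Q: "Q \<subseteq> {..<n}" "card Q \<le> dt_depth n (f i)"
    "\<forall>y\<in>cube n. (\<forall>i\<in>Q. x ! i = y ! i) \<longrightarrow> f i y = f i x"
    by (rule small_certificate[of x n "f i"]) (use x assms(2) in blast)+
  show ?thesis
  proof (rule that[of x "Some i" Q])
    show "card Q \<le> d" using Q(2) assms(3) i by fastforce
    have "(map (\<lambda>i. f i y) [0..<m], Some i) \<in> rel Least_Number m"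
      if "y \<in> X" "\<forall>i\<in>Q. x ! i = y ! i" for y
    proof -
      have "f i y" using Q(3) that x(2) assms(2) by blast
      then show ?thesis using i first[OF _ \<open>y \<in> X\<close>] by (auto simp: Least_Number_def cube_def)
    qed
    then show "\<forall>y\<in>X. (\<forall>i\<in>Q. x ! i = y ! i) \<longrightarrow>
        (map (\<lambda>i. f i y) [0..<m], Some i) \<in> rel Least_Number m" by blast
  qed (use i x Q in \<open>auto simp: Least_Number_def\<close>)
next
  case False
  obtain x where "x \<in> X" using assms(1) by blast
  show ?thesis
    \<comment> \<open>All bits vanish on all of \<open>X\<close>, so no input bit needs to be
      fixed.\<close>
    by (rule that[of x None "{}"]) (use False \<open>x \<in> X\<close> in \<open>auto simp: Least_Number_def cube_def\<close>)
qed

text \<open>The factor 2 pays for two certificates, one that keeps \<open>s\<close> a solution of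
  Least Number and one that keeps the value of \<open>g s\<close>.\<close>

lemma Least_Number_formulation_stable_solution:
  assumes form: "formulation R n Least_Number m f g"
    and m: "m \<in> lengths Least_Number"
    and compl: "complexity n Least_Number m f g \<le> c"
    and X: "X \<noteq> {}" "X \<subseteq> cube n"
  obtains x s Q where "x \<in> X" "s \<in> sols R n" "Q \<subseteq> {..<n}" "real (card Q) \<le> 2 * c"
    "\<forall>y\<in>X. (\<forall>i\<in>Q. x ! i = y ! i) \<longrightarrow> (y, s) \<in> rel R n"
proof -
  define D where "D = (\<lambda>i. dt_depth n (f i)) ` {..<m} \<union> (\<lambda>s. dt_depth n (g s)) ` sols Least_Number m"
  have "finite D" unfolding D_def by (simp add: Least_Number_def)
  then have f: "\<forall>i<m. dt_depth n (f i) \<le> Max D"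
    and g: "\<forall>s\<in>sols Least_Number m. dt_depth n (g s) \<le> Max D"
    by (auto simp: D_def intro!: Max_ge)
  have "1 \<le> m" using m by (auto simp: Least_Number_def)
  then have "0 \<le> log 2 (real m)" by simp
  with compl have Max: "real (Max D) \<le> c" unfolding complexity_def D_def by linarith
  obtain x s Q where Q: "x \<in> X" "s \<in> sols Least_Number m" "Q \<subseteq> {..<n}" "card Q \<le> Max D"
    "\<forall>y\<in>X. (\<forall>i\<in>Q. x ! i = y ! i) \<longrightarrow>
       (map (\<lambda>i. f i y) [0..<m], s) \<in> rel Least_Number m"
    by (rule Least_Number_stable_solution[OF X f])
  have x: "x \<in> cube n" using Q(1) X(2) by blast
  obtain Q' where Q': "Q' \<subseteq> {..<n}" "card Q' \<le> dt_depth n (g s)"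
    "\<forall>y\<in>cube n. (\<forall>i\<in>Q'. x ! i = y ! i) \<longrightarrow> g s y = g s x"
    by (rule small_certificate[OF x])
  show ?thesis
  proof (rule that[of x "g s x" "Q \<union> Q'"])
    show "g s x \<in> sols R n" using form Q(2) x unfolding formulation_def by blast
    have "card (Q \<union> Q') \<le> 2 * Max D"
      using card_Un_le[of Q Q'] Q(4) Q'(2) g Q(2) by fastforce
    with Max show "real (card (Q \<union> Q')) \<le> 2 * c" by linarith
    show "\<forall>y\<in>X. (\<forall>i\<in>Q \<union> Q'. x ! i = y ! i) \<longrightarrow> (y, g s x) \<in> rel R n"
    proof (intro ballI impI)
      fix y assume y: "y \<in> X" "\<forall>i\<in>Q \<union> Q'. x ! i = y ! i"
      have "y \<in> cube n" using y X by blast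
      moreover have "g s y = g s x" using Q'(3) y calculation by blast
      moreover have "(map (\<lambda>i. f i y) [0..<m], s) \<in> rel Least_Number m" using Q(5) y by blast
      ultimately show "(y, g s x) \<in> rel R n"
        using form Q(2) unfolding formulation_def by metis
    qed
  qed (use Q Q' in auto)
qed

section \<open>Linear orders as inputs of LOP\<close>

text \<open>An order is given by a rank function; ranks need not lie below \<open>N\<close>, so a
  new bottom element can be created by shifting the others.\<close>

definition order_of :: "nat \<Rightarrow> (nat \<Rightarrow> nat) \<Rightarrow> bool list" where
  "order_of N \<rho> = map (\<lambda>k. \<rho> (k div N) < \<rho> (k mod N)) [0..<N\<^sup>2]"

lemma order_of_in_cube: "order_of N \<rho> \<in> cube (N\<^sup>2)"
  by (simp add: order_of_def cube_def)

lemma nth_order_of: "k < N\<^sup>2 \<Longrightarrow> order_of N \<rho> ! k \<longleftrightarrow> \<rho> (k div N) < \<rho> (k mod N)"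
  by (simp add: order_of_def)

lemma prec_order_of:
  assumes "i < N" "j < N"
  shows "prec N (order_of N \<rho>) i j \<longleftrightarrow> \<rho> i < \<rho> j"
proof -
  have "i * N + j < (i + 1) * N" using assms by simp
  also have "\<dots> \<le> N * N" using assms by (intro mult_right_mono) auto
  finally have "i * N + j < N\<^sup>2" by (simp add: power2_eq_square)
  then show ?thesis using assms by (simp add: prec_def nth_order_of)
qed

lemma order_of_no_violation:
  assumes "inj \<rho>" "Violation a b c \<in> LOP_sols N"
  shows "\<not> LOP_holds N (order_of N \<rho>) (Violation a b c)"
proof -
  have "a < N" "b < N" "c < N" "a \<noteq> b" using assms(2) by (auto simp: LOP_sols_def)
  moreover have "\<rho> a \<noteq> \<rho> b" using \<open>a \<noteq> b\<close> assms(1) by (simp add: inj_eq)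
  ultimately show ?thesis by (auto simp: prec_order_of)
qed

lemma sols_LOP: "sols LOP (N\<^sup>2) = LOP_sols N"
  by (simp add: LOP_def)

lemma rel_LOP: "(x, s) \<in> rel LOP (N\<^sup>2) \<longleftrightarrow> x \<in> cube (N\<^sup>2) \<and> s \<in> LOP_sols N \<and> LOP_holds N x s"
  by (simp add: LOP_def)

text \<open>Each bit of \<open>Q\<close> mentions at most two elements. Together with the claimed
  minimum these are at most \<open>2 * card Q + 1\<close>, so some element is free to become the new
  minimum.\<close>

lemma LOP_no_stable_solution:
  assumes inj: "inj \<rho>" and s: "s \<in> LOP_sols N"
    and Q: "Q \<subseteq> {..<N\<^sup>2}" "2 * card Q + 1 < N"
  obtains \<sigma> where "inj \<sigma>" "\<forall>k\<in>Q. order_of N \<rho> ! k = order_of N \<sigma> ! k"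
    "\<not> LOP_holds N (order_of N \<sigma>) s"
proof (cases s)
  case (Violation a b c)
  \<comment> \<open>A linear order has no violations, so \<open>\<rho>\<close> itself serves as
    \<open>\<sigma>\<close>.\<close>
  with that[of \<rho>] show ?thesis using inj s order_of_no_violation by blast
next
  case (Minimum a)
  define U where "U = insert a ((\<lambda>k. k div N) ` Q \<union> (\<lambda>k. k mod N) ` Q)"
  have "finite Q" using Q(1) finite_subset by blast
  then have "card U \<le> Suc (card ((\<lambda>k. k div N) ` Q \<union> (\<lambda>k. k mod N) ` Q))"
    unfolding U_def by (simp add: card_insert_if)
  also have "\<dots> \<le> Suc (card Q + card Q)"
    using card_Un_le[of "(\<lambda>k. k div N) ` Q" "(\<lambda>k. k mod N) ` Q"]
      card_image_le[OF \<open>finite Q\<close>, of "\<lambda>k. k div N"] card_image_le[OF \<open>finite Q\<close>, of "\<lambda>k. k mod N"]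
    by linarith
  finally have "card U < card {..<N}" using Q(2) by simp
  moreover have "finite U" using \<open>finite Q\<close> by (simp add: U_def)
  ultimately obtain u where u: "u < N" "u \<notin> U"
    using card_mono[of U "{..<N}"] by (metis leD lessThan_iff subsetI)
  \<comment> \<open>\<open>Suc\<close> frees rank 0 for \<open>u\<close> and preserves all
    comparisons among the other elements.\<close>
  define \<sigma> where "\<sigma> = (\<lambda>v. if v = u then 0 else Suc (\<rho> v))"
  show ?thesis
  proof (rule that[of \<sigma>])
    show "inj \<sigma>"
      by (intro injI) (auto simp: \<sigma>_def inj_eq[OF inj] split: if_splits)
    show "\<forall>k\<in>Q. order_of N \<rho> ! k = order_of N \<sigma> ! k"
    proof
      fix k assume k: "k \<in> Q"
      then have "k div N \<noteq> u" "k mod N \<noteq> u" using u(2) unfolding U_def by blast+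
      then show "order_of N \<rho> ! k = order_of N \<sigma> ! k" using k Q(1) by (auto simp: nth_order_of \<sigma>_def)
    qed
    have "a < N" using s Minimum by (simp add: LOP_sols_def)
    moreover have "u \<noteq> a" using u(2) unfolding U_def by blast
    ultimately show "\<not> LOP_holds N (order_of N \<sigma>) s"
      using u(1) Minimum by (auto simp: prec_order_of \<sigma>_def intro!: exI[of _ u])
  qed
qed

text \<open>The factor 4 is 2 for the two certificates times 2 for the elements mentioned by each
  bit; the summand 1 is the claimed minimum.\<close>

lemma LOP_formulation_complexity:
  assumes "formulation LOP (N\<^sup>2) Least_Number m f g" "m \<in> lengths Least_Number"
  shows "real N \<le> 4 * complexity (N\<^sup>2) Least_Number m f g + 1"
proof (rule ccontr)
  define c where "c = complexity (N\<^sup>2) Least_Number m f g"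
  define X where "X = order_of N ` {\<rho>. inj \<rho>}"
  assume "\<not> real N \<le> 4 * complexity (N\<^sup>2) Least_Number m f g + 1"
  then have N: "4 * c + 1 < real N" by (simp add: c_def)
  have "order_of N id \<in> X" by (simp add: X_def)
  then have X: "X \<noteq> {}" "X \<subseteq> cube (N\<^sup>2)" using order_of_in_cube unfolding X_def by blast+
  obtain x s Q where Q: "x \<in> X" "s \<in> LOP_sols N" "Q \<subseteq> {..<N\<^sup>2}" "real (card Q) \<le> 2 * c"
    "\<forall>y\<in>X. (\<forall>i\<in>Q. x ! i = y ! i) \<longrightarrow> (y, s) \<in> rel LOP (N\<^sup>2)"
    by (rule Least_Number_formulation_stable_solution
        [OF assms eq_refl[OF c_def[symmetric]] X, unfolded sols_LOP])
  obtain \<rho> where \<rho>: "inj \<rho>" "x = order_of N \<rho>" using Q(1) by (auto simp: X_def)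
  have card_Q: "2 * card Q + 1 < N" using Q(4) N by linarith
  obtain \<sigma> where \<sigma>: "inj \<sigma>" "\<forall>k\<in>Q. order_of N \<rho> ! k = order_of N \<sigma> ! k"
    "\<not> LOP_holds N (order_of N \<sigma>) s"
    by (rule LOP_no_stable_solution[OF \<rho>(1) Q(2,3) card_Q])
  have "(order_of N \<sigma>, s) \<in> rel LOP (N\<^sup>2)"
    using Q(5) \<sigma>(1,2) \<rho>(2) by (auto simp: X_def)
  with \<sigma>(3) show False by (simp add: rel_LOP)
qed

section \<open>Asymptotic comparison\<close>

text \<open>The input length is \<open>N\<^sup>2\<close>, so a bound linear in \<open>N\<close> is
  of the order of its square root.\<close>

lemma polylog_smallo_sqrt:
  assumes "polylog p"
  shows "p \<in> o(\<lambda>n. sqrt (real n))"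
proof -
  obtain k :: nat where "p \<in> O(\<lambda>n. ln (real n) ^ k)" using assms by (auto simp: polylog_def)
  moreover have "(\<lambda>n. ln (real n) ^ k) \<in> o(\<lambda>n. sqrt (real n))" by real_asymp
  ultimately show ?thesis by (rule landau_o.big_small_trans)
qed

theorem theorem1p2:
  shows "LOP \<notin> MIN_dt \<and> \<not> (LOP \<le>\<^sub>d\<^sub>t Least_Number)"
proof -
  have "\<not> (LOP \<le>\<^sub>d\<^sub>t Least_Number)"
  proof
    assume "LOP \<le>\<^sub>d\<^sub>t Least_Number"
    then obtain p where p: "polylog p" and red: "\<And>n. n \<in> lengths LOP \<Longrightarrow>
        \<exists>m\<in>lengths Least_Number. \<exists>f g. formulation LOP n Least_Number m f g \<and>
          complexity n Least_Number m f g \<le> p n"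
      unfolding dt_reducible_def by blast
    \<comment> \<open>With 1/8 the lower bound becomes \<open>N \<le> N / 2 + 1\<close>, which fails
      for \<open>N \<ge> 3\<close>.\<close>
    have "eventually (\<lambda>n. norm (p n) \<le> 1 / 8 * norm (sqrt (real n))) sequentially"
      using landau_o.smallD[OF polylog_smallo_sqrt[OF p], of "1 / 8"] by simp
    then obtain n0 where n0: "\<And>n. n0 \<le> n \<Longrightarrow> \<bar>p n\<bar> \<le> 1 / 8 * sqrt (real n)"
      by (auto simp: eventually_sequentially)
    define N where "N = max 3 n0"
    have "n0 \<le> N\<^sup>2" unfolding N_def by (rule order.trans[OF _ self_le_power]) auto
    then have pN: "p (N\<^sup>2) \<le> 1 / 8 * real N" using n0[of "N\<^sup>2"] by simp
    have "N\<^sup>2 \<in> lengths LOP" by (auto simp: LOP_def N_def)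
    from red[OF this] obtain m f g where "m \<in> lengths Least_Number"
      "formulation LOP (N\<^sup>2) Least_Number m f g" "complexity (N\<^sup>2) Least_Number m f g \<le> p (N\<^sup>2)"
      by blast
    with LOP_formulation_complexity[of N m f g] pN have "real N \<le> 4 * (1 / 8 * real N) + 1"
      by linarith
    moreover have "3 \<le> real N" by (simp add: N_def)
    ultimately show False by simp
  qed
  then show ?thesis by (simp add: MIN_dt_def)
qed

end
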